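(* Let $\Phi$ be a gain graph with gain group $(\mathbb{Z}^d,+)$ and vertices $v_1,\dots,v_n$, with all weights $h_i\in\mathfrak{W}_1$, and let $\mathbf{m}=(\mathbf{m}_1,\dots,\mathbf{m}_n)\in(\mathbb{Z}^d)^n$, $M_i=\langle\mathbf{m}_i\rangle$. Then the list chromatic function $\chi_{(\Phi,h)}(\mathbf{m})$ is obtained from $(-1)^nQ_{(\Phi,h),M}(\mathbf{u},-1,0)$ by setting $u_{h',\mathbf{m}'}=-|h'\cap\langle\mathbf{m}'\rangle|$ for each $h'\in\mathfrak{W}_1$ and $\mathbf{m}'\in\mathbb{Z}^d$.
   Context: $\Phi$ has a finite graph with vertex set $V$ and edge set $E$ (links, loops, half edges, loose edges allowed; a loose edge is treated as a loop of gain $0$), gains $\varphi(e_{ij})\in\mathbb{Z}^d$ on links and loops with $\varphi(e_{ji})=-\varphi(e_{ij})$; path gains are sums; $\mathbb{Z}^d$ is ordered componentwise with $\vee$ the componentwise max. Colors are in $\mathbb{Z}^d$, with the group acting by translation. $\langle\mathbf{a}\rangle^*=\{\mathbf{x}\ge\mathbf{a}\}$, $\langle\mathbf{a}\rangle=\{\mathbf{x}\le\mathbf{a}\}$; $\mathfrak{W}_1$ is the class of subsets of $\mathbb{Z}^d$ contained in some $\langle\mathbf{a}\rangle^*$. An edge set is balanced if it has no half edges and all circles in it have gain $0$. For $S\subseteq E$: $c(S)$ = number of connected components of $(V,S)$, $b(S)$ = number of balanced ones, $\pi_b(S)$ their vertex sets; for a balanced component with vertex set $W$ and $v\in W$, $\eta_S(v)=\bigvee_{w\in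 W}\varphi(S_{vw})$, $S_{vw}$ any path in $S$ from $v$ to $w$. For $W\in\pi_b(S)$, $h/S(W)=\bigcap_{v_i\in W}(h_i+\eta_S(v_i))$ and $M/S(W)=\bigcap_{v_i\in W}(\langle\mathbf{m}_i\rangle+\eta_S(v_i))=\langle\mathbf{m}/S(W)\rangle$ for a point $\mathbf{m}/S(W)$. The doubly weighted total dichromatic polynomial is $Q_{(\Phi,h),M}(\mathbf{u},v,z)=\sum_{S\subseteq E}v^{|S|-n+b(S)}z^{c(S)-b(S)}\prod_{W\in\pi_b(S)}u_{h/S(W),\mathbf{m}/S(W)}$, with indeterminates $u_{h',\mathbf{m}'}$ ($h'\in\mathfrak{W}_1$, $\mathbf{m}'\in\mathbb{Z}^d$), $v$, $z$, and $0^0=1$. $\chi_{(\Phi,h)}(\mathbf{m})$ is the number of $\mathbf{x}:V\to\mathbb{Z}^d$ with $\mathbf{x}_i\in h_i$, $\mathbf{x}_i\le\mathbf{m}_i$, and $\mathbf{x}_j\ne\mathbf{x}_i+\varphi(e_{ij})$ for every link or loop $e_{ij}$ (loose edges always improper). *)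

theory Defs
  imports "HOL-Analysis.Finite_Cartesian_Product" "HOL-Library.Poly_Mapping"
    "HOL-Library.FuncSet"
begin

section \<open>Gain graphs with half and loose edges\<close>

text \<open>
  \<open>Ends i j\<close> is a link (\<open>i \<noteq> j\<close>) or a loop (\<open>i = j\<close>), listed with a reference orientation
  from \<open>i\<close> to \<open>j\<close>.  The field \<open>gain\<close> is the gain in that orientation; traversing the edge the
  other way negates it.  The values of \<open>gain\<close> on half and loose edges are irrelevant.
\<close>

datatype 'v incidence = Ends 'v 'v | Half 'v | Loose

record ('v, 'e, 'g) gain_graph =
  verts :: "'v set"
  edges :: "'e set"
  inc :: "'e \<Rightarrow> 'v incidence"
  gain :: "'e \<Rightarrow> 'g"

definition gain_graph :: "('v, 'e, 'g) gain_graph \<Rightarrow> bool" where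
  "gain_graph \<Phi> \<longleftrightarrow> finite (verts \<Phi>) \<and> finite (edges \<Phi>) \<and>
     (\<forall>e\<in>edges \<Phi>. set_incidence (inc \<Phi> e) \<subseteq> verts \<Phi>)"

text \<open>A step \<open>(e, b)\<close> traverses \<open>e\<close> in its reference orientation iff \<open>b\<close> holds.\<close>

fun step_from :: "('v, 'e, 'g) gain_graph \<Rightarrow> 'v \<Rightarrow> 'e \<times> bool \<Rightarrow> 'v \<Rightarrow> bool" where
  "step_from \<Phi> v (e, b) w \<longleftrightarrow> inc \<Phi> e = (if b then Ends v w else Ends w v)"

fun step_gain :: "('v, 'e, 'g::ab_group_add) gain_graph \<Rightarrow> 'e \<times> bool \<Rightarrow> 'g" where
  "step_gain \<Phi> (e, b) = (if b then gain \<Phi> e else - gain \<Phi> e)"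

text \<open>
  \<open>walk \<Phi> S v ps vs\<close>: the steps \<open>ps\<close>, all along edges of \<open>S\<close>, lead from \<open>v\<close> successively to the
  vertices \<open>vs\<close>.
\<close>

fun walk :: "('v, 'e, 'g) gain_graph \<Rightarrow> 'e set \<Rightarrow> 'v \<Rightarrow> ('e \<times> bool) list \<Rightarrow> 'v list \<Rightarrow> bool" where
  "walk \<Phi> S v [] [] \<longleftrightarrow> True"
| "walk \<Phi> S v (p # ps) (w # vs) \<longleftrightarrow> fst p \<in> S \<and> step_from \<Phi> v p w \<and> walk \<Phi> S w ps vs"
| "walk \<Phi> S v _ _ \<longleftrightarrow> False"

definition walk_gain :: "('v, 'e, 'g::ab_group_add) gain_graph \<Rightarrow> ('e \<times> bool) list \<Rightarrow> 'g" where
  "walk_gain \<Phi> ps = sum_list (map (step_gain \<Phi>) ps)"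

definition is_path ::
  "('v, 'e, 'g) gain_graph \<Rightarrow> 'e set \<Rightarrow> 'v \<Rightarrow> ('e \<times> bool) list \<Rightarrow> 'v \<Rightarrow> bool" where
  "is_path \<Phi> S v ps w \<longleftrightarrow>
     (\<exists>vs. walk \<Phi> S v ps vs \<and> distinct (v # vs) \<and> last (v # vs) = w)"

text \<open>Circles have length at least 1; those of length 1 are loops, those of length 2 consist of
  two distinct parallel links.\<close>

definition is_circle :: "('v, 'e, 'g) gain_graph \<Rightarrow> 'e set \<Rightarrow> ('e \<times> bool) list \<Rightarrow> bool" where
  "is_circle \<Phi> S ps \<longleftrightarrow>
     (\<exists>v vs. walk \<Phi> S v ps vs \<and> vs \<noteq> [] \<and> last vs = v \<and> distinct vs \<and> distinct (map fst ps))"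

definition balanced :: "('v, 'e, 'g::ab_group_add) gain_graph \<Rightarrow> 'e set \<Rightarrow> bool" where
  "balanced \<Phi> S \<longleftrightarrow>
     (\<forall>e\<in>S. \<forall>v. inc \<Phi> e \<noteq> Half v) \<and> (\<forall>ps. is_circle \<Phi> S ps \<longrightarrow> walk_gain \<Phi> ps = 0)"

definition conn :: "('v, 'e, 'g) gain_graph \<Rightarrow> 'e set \<Rightarrow> ('v \<times> 'v) set" where
  "conn \<Phi> S = {(v, w). v \<in> verts \<Phi> \<and> w \<in> verts \<Phi> \<and> (\<exists>ps. is_path \<Phi> S v ps w)}"

text \<open>Components are represented by their vertex sets.  A loose edge has no vertices, so it lies in
  no component and affects neither the number of components nor their balance, just like a loop of
  gain \<open>0\<close>.\<close>

definition components :: "('v, 'e, 'g) gain_graph \<Rightarrow> 'e set \<Rightarrow> 'v set set" where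
  "components \<Phi> S = verts \<Phi> // conn \<Phi> S"

definition edges_at :: "('v, 'e, 'g) gain_graph \<Rightarrow> 'e set \<Rightarrow> 'v set \<Rightarrow> 'e set" where
  "edges_at \<Phi> S W = {e \<in> S. set_incidence (inc \<Phi> e) \<inter> W \<noteq> {}}"

definition \<pi>\<^sub>b :: "('v, 'e, 'g::ab_group_add) gain_graph \<Rightarrow> 'e set \<Rightarrow> 'v set set" where
  "\<pi>\<^sub>b \<Phi> S = {W \<in> components \<Phi> S. balanced \<Phi> (edges_at \<Phi> S W)}"


section \<open>Weights\<close>

definition \<WW>\<^sub>1 :: "(int ^ 'd) set set" where
  "\<WW>\<^sub>1 = {X. \<exists>a. X \<subseteq> {a..}}"

text \<open>Within a balanced component the gain of a path depends only on its end points.\<close>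

definition path_gain :: "('v, 'e, 'g::ab_group_add) gain_graph \<Rightarrow> 'e set \<Rightarrow> 'v \<Rightarrow> 'v \<Rightarrow> 'g" where
  "path_gain \<Phi> S v w = walk_gain \<Phi> (SOME ps. is_path \<Phi> S v ps w)"

definition \<eta> :: "('v, 'e, int ^ 'd) gain_graph \<Rightarrow> 'e set \<Rightarrow> 'v \<Rightarrow> int ^ 'd" where
  "\<eta> \<Phi> S v = (\<chi> k. Max ((\<lambda>w. path_gain \<Phi> S v w $ k) ` (conn \<Phi> S `` {v})))"

text \<open>\<open>contract \<Phi> S h W\<close> is \<open>h/S(W)\<close>, and \<open>contract \<Phi> S M W\<close> is \<open>M/S(W)\<close>.\<close>

definition contract ::
  "('v, 'e, int ^ 'd) gain_graph \<Rightarrow> 'e set \<Rightarrow> ('v \<Rightarrow> (int ^ 'd) set) \<Rightarrow> 'v set \<Rightarrow> (int ^ 'd) set" where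
  "contract \<Phi> S h W = (\<Inter>v\<in>W. (\<lambda>x. x + \<eta> \<Phi> S v) ` h v)"

definition contract_top ::
  "('v, 'e, int ^ 'd) gain_graph \<Rightarrow> 'e set \<Rightarrow> ('v \<Rightarrow> (int ^ 'd) set) \<Rightarrow> 'v set \<Rightarrow> int ^ 'd" where
  "contract_top \<Phi> S M W = (THE p. contract \<Phi> S M W = {..p})"


section \<open>The doubly weighted total dichromatic polynomial\<close>

text \<open>Integer polynomials in an arbitrary family of indeterminates, as finitely supported functions
  on monomials.\<close>

type_synonym 'x int_mpoly = "('x \<Rightarrow>\<^sub>0 nat) \<Rightarrow>\<^sub>0 int"

definition indet :: "'x \<Rightarrow> 'x int_mpoly" where
  "indet x = Poly_Mapping.single (Poly_Mapping.single x 1) 1"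

definition eval_mpoly :: "('x \<Rightarrow> int) \<Rightarrow> 'x int_mpoly \<Rightarrow> int" where
  "eval_mpoly \<sigma> P =
     (\<Sum>\<mu>\<in>Poly_Mapping.keys P. Poly_Mapping.lookup P \<mu> *
        (\<Prod>x\<in>Poly_Mapping.keys \<mu>. \<sigma> x ^ Poly_Mapping.lookup \<mu> x))"

datatype 'c var = Var_u "'c set" 'c | Var_v | Var_z

text \<open>\<open>eval_uvz P u v z\<close> substitutes \<open>u h' m'\<close> for each \<open>u\<close>-indeterminate with index \<open>(h', m')\<close>.\<close>

definition eval_uvz :: "'c var int_mpoly \<Rightarrow> ('c set \<Rightarrow> 'c \<Rightarrow> int) \<Rightarrow> int \<Rightarrow> int \<Rightarrow> int" where
  "eval_uvz P u v z =
     eval_mpoly (\<lambda>x. case x of Var_u h' m' \<Rightarrow> u h' m' | Var_v \<Rightarrow> v | Var_z \<Rightarrow> z) P"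

text \<open>The truncated subtraction in the exponent of \<open>v\<close> is harmless: an unbalanced component with
  \<open>k\<close> vertices has at least \<open>k\<close> edges, a balanced one at least \<open>k - 1\<close>.\<close>

definition total_dichromatic ::
  "('v, 'e, int ^ 'd) gain_graph \<Rightarrow> ('v \<Rightarrow> (int ^ 'd) set) \<Rightarrow> ('v \<Rightarrow> (int ^ 'd) set)
    \<Rightarrow> (int ^ 'd) var int_mpoly" where
  "total_dichromatic \<Phi> h M =
     (\<Sum>S\<in>Pow (edges \<Phi>).
        indet Var_v ^ (card S + card (\<pi>\<^sub>b \<Phi> S) - card (verts \<Phi>)) *
        indet Var_z ^ (card (components \<Phi> S) - card (\<pi>\<^sub>b \<Phi> S)) *
        (\<Prod>W\<in>\<pi>\<^sub>b \<Phi> S. indet (Var_u (contract \<Phi> S h W) (contract_top \<Phi> S M W))))"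


section \<open>The list chromatic function\<close>

definition proper :: "('v, 'e, 'g::ab_group_add) gain_graph \<Rightarrow> ('v \<Rightarrow> 'g) \<Rightarrow> bool" where
  "proper \<Phi> x \<longleftrightarrow>
     (\<forall>e\<in>edges \<Phi>. case inc \<Phi> e of
        Ends i j \<Rightarrow> x j \<noteq> x i + gain \<Phi> e
      | Half i \<Rightarrow> True
      | Loose \<Rightarrow> False)"

definition list_chromatic ::
  "('v, 'e, int ^ 'd) gain_graph \<Rightarrow> ('v \<Rightarrow> (int ^ 'd) set) \<Rightarrow> ('v \<Rightarrow> int ^ 'd) \<Rightarrow> nat" where
  "list_chromatic \<Phi> h m =
     card {x \<in> verts \<Phi> \<rightarrow>\<^sub>E UNIV. (\<forall>i\<in>verts \<Phi>. x i \<in> h i \<and> x i \<le> m i) \<and> proper \<Phi> x}"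

end

theory Submission
  imports Defs
begin

text \<open>
  By inclusion-exclusion over the set of violated edges, the number of proper colorings in the
  finite box \<open>x i \<in> h i\<close>, \<open>x i \<le> m i\<close> is the alternating sum over \<open>S\<close> of the number of
  colorings in the box that violate every edge of \<open>S\<close>.  A coloring satisfying the equations of
  \<open>S\<close> is a potential for the gains on \<open>S\<close>, so it exists only if \<open>S\<close> is balanced; setting
  \<open>z = 0\<close> leaves exactly these \<open>S\<close>.  For balanced \<open>S\<close> the vector \<open>x v + \<eta> \<Phi> S v\<close> is
  constant on each component \<open>W\<close> and ranges freely over \<open>h/S(W) \<inter> M/S(W)\<close>, so the number of such
  colorings is the product of the specialized indeterminates up to sign.
\<close>

section \<open>Evaluation of integer polynomials as a ring homomorphism\<close>

text \<open>Monomials outside the support have coefficient \<open>0\<close>, so polynomials with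
  different supports can be evaluated over one common finite set.\<close>

lemma eval_mpoly_superset:
  assumes "finite A" "Poly_Mapping.keys P \<subseteq> A"
  shows "eval_mpoly \<sigma> P = (\<Sum>\<mu>\<in>A. Poly_Mapping.lookup P \<mu> *
        (\<Prod>x\<in>Poly_Mapping.keys \<mu>. \<sigma> x ^ Poly_Mapping.lookup \<mu> x))"
  unfolding eval_mpoly_def
  by (rule sum.mono_neutral_left) (use assms in \<open>auto simp: in_keys_iff\<close>)

lemma eval_mpoly_zero: "eval_mpoly \<sigma> 0 = 0"
  by (simp add: eval_mpoly_def)

lemma eval_mpoly_add: "eval_mpoly \<sigma> (P + Q) = eval_mpoly \<sigma> P + eval_mpoly \<sigma> Q"
proof -
  let ?A = "Poly_Mapping.keys P \<union> Poly_Mapping.keys Q"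
  have "Poly_Mapping.keys (P + Q) \<subseteq> ?A"
    by (rule Poly_Mapping.keys_add)
  then show ?thesis
    by (simp add: eval_mpoly_superset[of ?A] lookup_add sum.distrib distrib_right)
qed

lemma eval_mpoly_sum: "eval_mpoly \<sigma> (\<Sum>i\<in>I. P i) = (\<Sum>i\<in>I. eval_mpoly \<sigma> (P i))"
  by (induction I rule: infinite_finite_induct) (simp_all add: eval_mpoly_zero eval_mpoly_add)

lemma eval_mpoly_single:
  "eval_mpoly \<sigma> (Poly_Mapping.single \<mu> c) =
     c * (\<Prod>x\<in>Poly_Mapping.keys \<mu>. \<sigma> x ^ Poly_Mapping.lookup \<mu> x)"
  by (simp add: eval_mpoly_superset[of "{\<mu>}"])

text \<open>Over the union of both supports every absent variable contributes
  \<open>\<sigma> x ^ 0 = 1\<close>, so adding exponents multiplies the values factor by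
  factor.\<close>

lemma monomial_value_add:
  fixes \<sigma> :: "'x \<Rightarrow> int"
  shows "(\<Prod>x\<in>Poly_Mapping.keys (\<mu> + \<nu>). \<sigma> x ^ Poly_Mapping.lookup (\<mu> + \<nu>) x) =
     (\<Prod>x\<in>Poly_Mapping.keys \<mu>. \<sigma> x ^ Poly_Mapping.lookup \<mu> x) *
     (\<Prod>x\<in>Poly_Mapping.keys \<nu>. \<sigma> x ^ Poly_Mapping.lookup \<nu> x)"
proof -
  let ?A = "Poly_Mapping.keys \<mu> \<union> Poly_Mapping.keys \<nu>"
  have *: "(\<Prod>x\<in>Poly_Mapping.keys \<rho>. \<sigma> x ^ Poly_Mapping.lookup \<rho> x) =
      (\<Prod>x\<in>?A. \<sigma> x ^ Poly_Mapping.lookup \<rho> x)" if "Poly_Mapping.keys \<rho> \<subseteq> ?A" for \<rho>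
    by (rule prod.mono_neutral_left) (use that in \<open>auto simp: in_keys_iff\<close>)
  show ?thesis
    using *[of \<mu>] *[of \<nu>] *[OF Poly_Mapping.keys_add]
    by (simp add: lookup_add power_add prod.distrib)
qed

text \<open>Updating at a key outside the support is the same as adding a single monomial. In this
  additive form the induction works directly with distributivity.\<close>

lemma poly_mapping_single_add_induct [case_names zero single_add]:
  fixes P :: "'a \<Rightarrow>\<^sub>0 'b::comm_monoid_add"
  assumes "R 0" and "\<And>\<mu> c Q. R Q \<Longrightarrow> R (Poly_Mapping.single \<mu> c + Q)"
  shows "R P"
proof (induction P rule: update_induct)
  case (update f a b)
  then have "Poly_Mapping.update a b f = Poly_Mapping.single a b + f"
    by (intro poly_mapping_eqI) (auto simp: lookup_update lookup_add lookup_single in_keys_iff)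
  then show ?case
    using assms(2) update by simp
qed (fact assms(1))

lemma eval_mpoly_mult: "eval_mpoly \<sigma> (P * Q) = eval_mpoly \<sigma> P * eval_mpoly \<sigma> Q"
proof (induction P rule: poly_mapping_single_add_induct)
  case (single_add \<mu> c P)
  \<comment> \<open>A second induction, on \<open>Q\<close>, reduces the claim to a product of two
    single monomials, where exponents add.\<close>
  have "eval_mpoly \<sigma> (Poly_Mapping.single \<mu> c * Q) =
      eval_mpoly \<sigma> (Poly_Mapping.single \<mu> c) * eval_mpoly \<sigma> Q"
    by (induction Q rule: poly_mapping_single_add_induct)
      (simp_all add: eval_mpoly_zero mult_single eval_mpoly_single monomial_value_add distrib_left
        eval_mpoly_add)
  with single_add show ?case
    by (simp add: distrib_right eval_mpoly_add)
qed (simp add: eval_mpoly_zero)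

lemma eval_mpoly_one: "eval_mpoly \<sigma> 1 = 1"
  using eval_mpoly_single[of \<sigma> 0 1] by simp

lemma eval_mpoly_power: "eval_mpoly \<sigma> (P ^ k) = eval_mpoly \<sigma> P ^ k"
  by (induction k) (simp_all add: eval_mpoly_one eval_mpoly_mult)

lemma eval_mpoly_prod: "eval_mpoly \<sigma> (\<Prod>i\<in>I. P i) = (\<Prod>i\<in>I. eval_mpoly \<sigma> (P i))"
  by (induction I rule: infinite_finite_induct) (simp_all add: eval_mpoly_one eval_mpoly_mult)

lemma eval_mpoly_indet: "eval_mpoly \<sigma> (indet x) = \<sigma> x"
  by (simp add: indet_def eval_mpoly_single)

section \<open>Walks and their reduction to paths\<close>

lemma walk_length: "walk \<Phi> S v ps vs \<Longrightarrow> length ps = length vs"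
  by (induction \<Phi> S v ps vs rule: walk.induct) auto

lemma walk_append:
  assumes "length ps = length vs"
  shows "walk \<Phi> S v (ps @ qs) (vs @ us) \<longleftrightarrow> walk \<Phi> S v ps vs \<and> walk \<Phi> S (last (v # vs)) qs us"
  using assms by (induction ps vs arbitrary: v rule: list_induct2) auto

lemma walk_mono:
  assumes "walk \<Phi> S v ps vs" "fst ` set ps \<subseteq> T"
  shows "walk \<Phi> T v ps vs"
  using assms by (induction \<Phi> S v ps vs rule: walk.induct) auto

lemma walk_edges: "walk \<Phi> S v ps vs \<Longrightarrow> fst ` set ps \<subseteq> S"
  by (induction \<Phi> S v ps vs rule: walk.induct) auto

lemma step_from_ends:
  "step_from \<Phi> v p w \<Longrightarrow> inc \<Phi> (fst p) = Ends v w \<or> inc \<Phi> (fst p) = Ends w v"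
  by (cases p) (auto split: if_splits)

lemma walk_edge_ends:
  assumes "walk \<Phi> S v ps vs" "e \<in> fst ` set ps"
  shows "\<exists>a b. inc \<Phi> e = Ends a b \<and> a \<in> set (v # vs) \<and> b \<in> set (v # vs)"
  using assms
proof (induction \<Phi> S v ps vs rule: walk.induct)
  case (2 \<Phi> S v p ps w vs)
  show ?case
  proof (cases "e = fst p")
    case True
    then show ?thesis
      using 2(2) step_from_ends[of \<Phi> v p w] by auto
  next
    case False
    then have "\<exists>a b. inc \<Phi> e = Ends a b \<and> a \<in> set (w # vs) \<and> b \<in> set (w # vs)"
      using 2 by simp
    then show ?thesis
      by (meson list.set_intros(2))
  qed
qed auto

text \<open>If the first edge were used again, its end \<open>v\<close> would reappear among the
  later vertices.\<close>

lemma path_distinct_edges: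
  assumes "walk \<Phi> S v ps vs" "distinct (v # vs)"
  shows "distinct (map fst ps)"
  using assms
proof (induction \<Phi> S v ps vs rule: walk.induct)
  case (2 \<Phi> S v p ps w vs)
  have "fst p \<notin> fst ` set ps"
  proof
    assume "fst p \<in> fst ` set ps"
    then obtain a b where "inc \<Phi> (fst p) = Ends a b" "a \<in> set (w # vs)" "b \<in> set (w # vs)"
      using walk_edge_ends[of \<Phi> S w ps vs "fst p"] 2(2) by auto
    then show False
      using 2(2,3) step_from_ends[of \<Phi> v p w] by auto
  qed
  then show ?case
    using 2 by auto
qed auto

text \<open>Since \<open>e\<close> is incident with \<open>w\<close>, which occurs only at the
  start, \<open>e\<close> is the first step. It leads to \<open>v\<close>, where the path must stop.
  This treats the closed walk that returns along its first edge and so is not a circle.\<close>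

lemma path_using_edge_between_ends:
  assumes "walk \<Phi> S w q ys" "distinct (w # ys)" "last (w # ys) = v" "v \<noteq> w"
    and e: "e \<in> fst ` set q" "inc \<Phi> e = Ends v w \<or> inc \<Phi> e = Ends w v"
  obtains b where "q = [(e, b)]" "step_from \<Phi> w (e, b) v"
proof -
  from e(1) obtain q0 q' where q: "q = q0 # q'"
    by (cases q) auto
  with assms(1) obtain y0 ys' where ys: "ys = y0 # ys'"
    by (cases ys) auto
  have w: "walk \<Phi> S y0 q' ys'" "step_from \<Phi> w q0 y0"
    using assms(1) by (simp_all add: q ys)
  have "e \<notin> fst ` set q'"
  proof
    assume "e \<in> fst ` set q'"
    then show False
      using walk_edge_ends[OF w(1)] e(2) assms(2) by (fastforce simp: ys)
  qed
  then have e0: "fst q0 = e"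
    using e(1) by (auto simp: q)
  then have "y0 = v"
    using step_from_ends[OF w(2)] e(2) assms(4) by auto
  then have "ys' = []"
    using assms(2,3) by (cases ys' rule: rev_cases) (auto simp: ys split: if_splits)
  then have "q' = []"
    using walk_length[OF w(1)] by simp
  then show ?thesis
    using that[of "snd q0"] e0 w(2) \<open>y0 = v\<close> by (cases q0) (auto simp: q)
qed

lemma walk_gain_simps [simp]:
  "walk_gain \<Phi> [] = 0"
  "walk_gain \<Phi> (p # ps) = step_gain \<Phi> p + walk_gain \<Phi> ps"
  "walk_gain \<Phi> (ps @ qs) = walk_gain \<Phi> ps + walk_gain \<Phi> qs"
  by (simp_all add: walk_gain_def)

lemma balanced_circle:
  assumes "balanced \<Phi> S" "walk \<Phi> S v ps vs" "vs \<noteq> []" "last vs = v" "distinct vs"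
    "distinct (map fst ps)"
  shows "walk_gain \<Phi> ps = 0"
  using assms unfolding balanced_def is_circle_def by blast

text \<open>Cutting out a closed subwalk either removes a circle or an edge that is traversed forth and
  back, so in a balanced set the gain survives.\<close>

lemma walk_imp_path:
  assumes "walk \<Phi> S v ps vs"
  shows "\<exists>qs us. walk \<Phi> S v qs us \<and> distinct (v # us) \<and> last (v # us) = last (v # vs) \<and>
           (balanced \<Phi> S \<longrightarrow> walk_gain \<Phi> qs = walk_gain \<Phi> ps)"
  using assms
proof (induction \<Phi> S v ps vs rule: walk.induct)
  case (1 \<Phi> S v)
  then show ?case
    by (intro exI[of _ "[]"]) auto
next
  case (2 \<Phi> S v p ps w vs)
  then have p: "fst p \<in> S" "step_from \<Phi> v p w"
    by auto
  from 2 obtain qs us where qs: "walk \<Phi> S w qs us" "distinct (w # us)"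
      "last (w # us) = last (w # vs)"
      "balanced \<Phi> S \<Longrightarrow> walk_gain \<Phi> qs = walk_gain \<Phi> ps"
    by auto
  show ?case
  proof (cases "v \<in> set (w # us)")
    case False
    then show ?thesis
      using qs p by (intro exI[of _ "p # qs"] exI[of _ "w # us"]) auto
  next
    case True
    then obtain xs zs where split: "w # us = xs @ v # zs"
      by (meson split_list)
    show ?thesis
    proof (cases xs)
      case Nil
      then have [simp]: "v = w" "us = zs"
        using split by auto
      \<comment> \<open>Here \<open>p\<close> is a loop, a circle of length 1, and dropping it
        leaves the path \<open>qs\<close>.\<close>
      have "step_gain \<Phi> p = 0" if "balanced \<Phi> S"
        using balanced_circle[OF that, of v "[p]" "[w]"] p by simp
      then show ?thesis
        using qs by (intro exI[of _ qs] exI[of _ us]) auto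
    next
      case (Cons x xs')
      then have us: "us = (xs' @ [v]) @ zs"
        using split by auto
      \<comment> \<open>The vertex \<open>v\<close> has index \<open>length xs'\<close> in
        \<open>us\<close>, and step number \<open>k\<close> ends at entry number \<open>k\<close> of
        \<open>us\<close>, so the return to \<open>v\<close> takes one step more than that
        index.\<close>
      define q1 q2 where "q1 = take (Suc (length xs')) qs" and "q2 = drop (Suc (length xs')) qs"
      have len: "length q1 = length (xs' @ [v])"
        using walk_length[OF qs(1)] by (simp add: q1_def us)
      have "qs = q1 @ q2"
        by (simp add: q1_def q2_def)
      then have q12: "walk \<Phi> S w q1 (xs' @ [v])" "walk \<Phi> S v q2 zs"
        using qs(1) walk_append[OF len, of \<Phi> S w q2 zs] by (simp_all add: us)
      have "v \<noteq> w"
        using qs(2) by (auto simp: us)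
      have zero: "step_gain \<Phi> p + walk_gain \<Phi> q1 = 0" if bal: "balanced \<Phi> S"
      proof (cases "fst p \<in> fst ` set q1")
        case False
        have "distinct (map fst q1)"
          using path_distinct_edges[OF q12(1)] qs(2) by (auto simp: us)
        then show ?thesis
          using balanced_circle[OF bal, of v "p # q1" "w # xs' @ [v]"] False p q12 qs(2)
          by (auto simp: us)
      next
        case True
        obtain b where "q1 = [(fst p, b)]" "step_from \<Phi> w (fst p, b) v"
          using path_using_edge_between_ends[OF q12(1) _ _ \<open>v \<noteq> w\<close> True] step_from_ends[OF p(2)]
            qs(2) by (auto simp: us)
        then show ?thesis
          using p(2) \<open>v \<noteq> w\<close> by (cases p) (auto split: if_splits)
      qed
      have "walk_gain \<Phi> q2 = step_gain \<Phi> p + walk_gain \<Phi> ps" if bal: "balanced \<Phi> S"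
        using zero[OF bal] qs(4)[OF bal] \<open>qs = q1 @ q2\<close>
        by (metis add.assoc add_0 walk_gain_simps(3))
      then show ?thesis
        using q12(2) qs(2,3) by (intro exI[of _ q2] exI[of _ zs]) (auto simp: us)
    qed
  qed
qed auto

section \<open>Gains of walks in balanced edge sets\<close>

text \<open>Dropping distinctness of vertices lets walks be concatenated and reversed freely, which
  paths do not allow.\<close>

definition reach ::
  "('v, 'e, 'g) gain_graph \<Rightarrow> 'e set \<Rightarrow> 'v \<Rightarrow> ('e \<times> bool) list \<Rightarrow> 'v \<Rightarrow> bool" where
  "reach \<Phi> S v ps w \<longleftrightarrow> (\<exists>vs. walk \<Phi> S v ps vs \<and> last (v # vs) = w)"

lemma reach_Nil [simp]: "reach \<Phi> S v [] w \<longleftrightarrow> v = w"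
proof -
  have "walk \<Phi> S v [] vs \<longleftrightarrow> vs = []" for vs
    by (cases vs) auto
  then show ?thesis
    by (auto simp: reach_def)
qed

lemma reach_Cons:
  "reach \<Phi> S v (p # ps) w \<longleftrightarrow> (\<exists>x. fst p \<in> S \<and> step_from \<Phi> v p x \<and> reach \<Phi> S x ps w)"
proof -
  have "walk \<Phi> S v (p # ps) vs \<longleftrightarrow>
      (\<exists>x us. vs = x # us \<and> fst p \<in> S \<and> step_from \<Phi> v p x \<and> walk \<Phi> S x ps us)" for vs
    by (cases vs) auto
  then show ?thesis
    unfolding reach_def by fastforce
qed

lemma reach_append:
  "reach \<Phi> S v (ps @ qs) w \<longleftrightarrow> (\<exists>x. reach \<Phi> S v ps x \<and> reach \<Phi> S x qs w)"
  by (induction ps arbitrary: v) (auto simp: reach_Cons)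

definition reverse_walk :: "('e \<times> bool) list \<Rightarrow> ('e \<times> bool) list" where
  "reverse_walk ps = rev (map (\<lambda>(e, b). (e, \<not> b)) ps)"

lemma reach_reverse: "reach \<Phi> S v ps w \<Longrightarrow> reach \<Phi> S w (reverse_walk ps) v"
proof (induction ps arbitrary: v)
  case (Cons p ps)
  then show ?case
    by (cases p) (fastforce simp: reverse_walk_def reach_Cons reach_append)
qed (simp add: reverse_walk_def)

lemma walk_gain_reverse: "walk_gain \<Phi> (reverse_walk ps) = - walk_gain \<Phi> ps"
proof (induction ps)
  case (Cons p ps)
  then show ?case
    by (cases p) (auto simp: reverse_walk_def)
qed (simp add: reverse_walk_def)

lemma is_path_imp_reach: "is_path \<Phi> S v ps w \<Longrightarrow> reach \<Phi> S v ps w"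
  unfolding is_path_def reach_def by blast

lemma reach_imp_path:
  assumes "reach \<Phi> S v ps w"
  obtains qs where "is_path \<Phi> S v qs w" "balanced \<Phi> S \<Longrightarrow> walk_gain \<Phi> qs = walk_gain \<Phi> ps"
proof -
  from assms obtain vs where "walk \<Phi> S v ps vs" "last (v # vs) = w"
    by (auto simp: reach_def)
  then show ?thesis
    using that walk_imp_path[of \<Phi> S v ps vs] unfolding is_path_def by blast
qed

text \<open>Reduction to a path preserves the gain, and the only path from \<open>v\<close> to
  itself is empty.\<close>

lemma balanced_closed_walk_gain:
  assumes "balanced \<Phi> S" "reach \<Phi> S v ps v"
  shows "walk_gain \<Phi> ps = 0"
proof -
  obtain qs where qs: "is_path \<Phi> S v qs v" "walk_gain \<Phi> qs = walk_gain \<Phi> ps"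
    using reach_imp_path[OF assms(2)] assms(1) by blast
  then obtain us where us: "walk \<Phi> S v qs us" "distinct (v # us)" "last (v # us) = v"
    by (auto simp: is_path_def)
  then have "us = []"
    by (cases us rule: rev_cases) auto
  then have "qs = []"
    using walk_length[OF us(1)] by simp
  then show ?thesis
    using qs(2) by simp
qed

lemma balanced_walk_gain_eq:
  assumes "balanced \<Phi> S" "reach \<Phi> S v ps w" "reach \<Phi> S v qs w"
  shows "walk_gain \<Phi> ps = walk_gain \<Phi> qs"
proof -
  have "reach \<Phi> S v (ps @ reverse_walk qs) v"
    using assms(2) reach_reverse[OF assms(3)] by (auto simp: reach_append)
  from balanced_closed_walk_gain[OF assms(1) this] show ?thesis
    by (simp add: walk_gain_reverse)
qed

text \<open>Any walk may stand in for the arbitrarily chosen path in \<open>path_gain\<close>,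
  because all walks between the same ends have the same gain.\<close>

lemma path_gain_eq:
  assumes "balanced \<Phi> S" "reach \<Phi> S v ps w"
  shows "path_gain \<Phi> S v w = walk_gain \<Phi> ps"
proof -
  obtain qs where "is_path \<Phi> S v qs w"
    using reach_imp_path[OF assms(2)] by blast
  then have "is_path \<Phi> S v (SOME ps. is_path \<Phi> S v ps w) w"
    by (rule someI)
  then show ?thesis
    unfolding path_gain_def
    by (intro balanced_walk_gain_eq[OF assms(1) is_path_imp_reach assms(2)])
qed

section \<open>Connected components and balance\<close>

text \<open>With walks in place of paths, symmetry and transitivity become reversal and
  concatenation. The group sort comes from the path reduction, which keeps track of gains.\<close>

lemma conn_iff:
  fixes \<Phi> :: "('v, 'e, 'g::ab_group_add) gain_graph"
  shows "(v, w) \<in> conn \<Phi> S \<longleftrightarrow> v \<in> verts \<Phi> \<and> w \<in> verts \<Phi> \<and> (\<exists>ps. reach \<Phi> S v ps w)"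
  unfolding conn_def by (auto intro: is_path_imp_reach elim: reach_imp_path)

lemma equiv_conn:
  fixes \<Phi> :: "('v, 'e, 'g::ab_group_add) gain_graph"
  shows "equiv (verts \<Phi>) (conn \<Phi> S)"
proof (rule equivI)
  show "conn \<Phi> S \<subseteq> verts \<Phi> \<times> verts \<Phi>"
    by (auto simp: conn_def)
  show "refl_on (verts \<Phi>) (conn \<Phi> S)"
    by (auto simp: refl_on_def conn_iff intro: exI[of _ "[]"])
  show "sym (conn \<Phi> S)"
    by (rule symI) (auto simp: conn_iff dest: reach_reverse)
  show "trans (conn \<Phi> S)"
  proof (rule transI)
    fix x y z assume "(x, y) \<in> conn \<Phi> S" "(y, z) \<in> conn \<Phi> S"
    then obtain ps qs where "x \<in> verts \<Phi>" "z \<in> verts \<Phi>" "reach \<Phi> S x ps y" "reach \<Phi> S y qs z"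
      by (auto simp: conn_iff)
    then show "(x, z) \<in> conn \<Phi> S"
      unfolding conn_iff by (metis reach_append)
  qed
qed

lemma component_closed:
  fixes \<Phi> :: "('v, 'e, 'g::ab_group_add) gain_graph"
  assumes "W \<in> components \<Phi> S" "v \<in> W" "(v, w) \<in> conn \<Phi> S"
  shows "w \<in> W"
  using in_quotient_imp_closed[OF equiv_conn assms(1)[unfolded components_def] assms(2,3)] .

lemma component_subset:
  fixes \<Phi> :: "('v, 'e, 'g::ab_group_add) gain_graph"
  shows "W \<in> components \<Phi> S \<Longrightarrow> W \<subseteq> verts \<Phi>"
  unfolding components_def by (rule in_quotient_imp_subset[OF equiv_conn])

lemma component_nonempty:
  fixes \<Phi> :: "('v, 'e, 'g::ab_group_add) gain_graph"
  shows "W \<in> components \<Phi> S \<Longrightarrow> W \<noteq> {}"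
  unfolding components_def by (rule in_quotient_imp_non_empty[OF equiv_conn])

lemma component_of:
  fixes \<Phi> :: "('v, 'e, 'g::ab_group_add) gain_graph"
  shows "v \<in> verts \<Phi> \<Longrightarrow> conn \<Phi> S `` {v} \<in> components \<Phi> S"
  unfolding components_def by (rule quotientI)

lemma in_component_of:
  fixes \<Phi> :: "('v, 'e, 'g::ab_group_add) gain_graph"
  shows "v \<in> verts \<Phi> \<Longrightarrow> v \<in> conn \<Phi> S `` {v}"
  by (rule equiv_class_self[OF equiv_conn])

lemma component_of_eq:
  fixes \<Phi> :: "('v, 'e, 'g::ab_group_add) gain_graph"
  assumes "W \<in> components \<Phi> S" "v \<in> W"
  shows "conn \<Phi> S `` {v} = W"
proof -
  have "v \<in> verts \<Phi>"
    using assms component_subset by blast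
  then show ?thesis
    using quotient_disj[OF equiv_conn, of W \<Phi> S "conn \<Phi> S `` {v}"] assms
      component_of[of v \<Phi> S] in_component_of[of v \<Phi> S]
    unfolding components_def by blast
qed

lemma finite_components: "finite (verts \<Phi>) \<Longrightarrow> finite (components \<Phi> S)"
  unfolding components_def
  by (rule finite_quotient) (auto simp: conn_def)

lemma step_from_verts:
  fixes \<Phi> :: "('v, 'e, 'g::ab_group_add) gain_graph"
  assumes "gain_graph \<Phi>" "S \<subseteq> edges \<Phi>" "fst p \<in> S" "step_from \<Phi> v p w"
  shows "v \<in> verts \<Phi>" "w \<in> verts \<Phi>" "(v, w) \<in> conn \<Phi> S"
proof -
  have "set_incidence (inc \<Phi> (fst p)) \<subseteq> verts \<Phi>"
    using assms(1-3) by (auto simp: gain_graph_def)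
  then show vw: "v \<in> verts \<Phi>" "w \<in> verts \<Phi>"
    using step_from_ends[OF assms(4)] by auto
  have "reach \<Phi> S v [p] w"
    using assms(3,4) by (simp add: reach_Cons)
  then show "(v, w) \<in> conn \<Phi> S"
    using vw by (auto simp: conn_iff)
qed

text \<open>Every step stays inside the component, so every edge used meets
  \<open>W\<close>.\<close>

lemma walk_edges_at:
  fixes \<Phi> :: "('v, 'e, 'g::ab_group_add) gain_graph"
  assumes "walk \<Phi> S v ps vs" "gain_graph \<Phi>" "S \<subseteq> edges \<Phi>" "W \<in> components \<Phi> S" "v \<in> W"
  shows "walk \<Phi> (edges_at \<Phi> S W) v ps vs"
  using assms
proof (induction \<Phi> S v ps vs rule: walk.induct)
  case (2 \<Phi> S v p ps w vs)
  then have p: "fst p \<in> S" "step_from \<Phi> v p w"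
    by auto
  have "w \<in> W"
    by (rule component_closed[OF 2(5,6) step_from_verts(3)[OF 2(3,4) p]])
  moreover have "fst p \<in> edges_at \<Phi> S W"
    using p step_from_ends[OF p(2)] \<open>v \<in> W\<close> by (auto simp: edges_at_def)
  moreover have "walk \<Phi> S w ps vs"
    using 2(2) by simp
  ultimately show ?case
    using 2(1)[OF _ 2(3-5)] p by simp
qed auto

lemma balanced_mono:
  assumes "balanced \<Phi> S" "T \<subseteq> S"
  shows "balanced \<Phi> T"
proof -
  have "is_circle \<Phi> S ps" if "is_circle \<Phi> T ps" for ps
    using that assms(2) unfolding is_circle_def by (meson order_trans walk_edges walk_mono)
  then show ?thesis
    using assms unfolding balanced_def by blast
qed

text \<open>Each obstruction to balance, a half edge or a circle of nonzero gain, lies in a single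
  component. Hence the exponent of \<open>z\<close> vanishes exactly for balanced
  \<open>S\<close>.\<close>

lemma balanced_iff_components:
  fixes \<Phi> :: "('v, 'e, 'g::ab_group_add) gain_graph"
  assumes "gain_graph \<Phi>" "S \<subseteq> edges \<Phi>"
  shows "balanced \<Phi> S \<longleftrightarrow> \<pi>\<^sub>b \<Phi> S = components \<Phi> S"
proof
  assume "balanced \<Phi> S"
  moreover have "edges_at \<Phi> S W \<subseteq> S" for W
    by (auto simp: edges_at_def)
  ultimately show "\<pi>\<^sub>b \<Phi> S = components \<Phi> S"
    by (auto simp: \<pi>\<^sub>b_def intro: balanced_mono)
next
  assume "\<pi>\<^sub>b \<Phi> S = components \<Phi> S"
  then have bal: "balanced \<Phi> (edges_at \<Phi> S (conn \<Phi> S `` {v}))" if "v \<in> verts \<Phi>" for v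
    using component_of[OF that] by (auto simp: \<pi>\<^sub>b_def)
  show "balanced \<Phi> S"
    unfolding balanced_def
  proof (intro conjI ballI allI impI notI)
    fix e v assume e: "e \<in> S" "inc \<Phi> e = Half v"
    then have v: "v \<in> verts \<Phi>"
      using assms by (force simp: gain_graph_def)
    then have "e \<in> edges_at \<Phi> S (conn \<Phi> S `` {v})"
      using e in_component_of[OF v] by (auto simp: edges_at_def)
    then show False
      using bal[OF v] e by (auto simp: balanced_def)
  next
    fix ps assume "is_circle \<Phi> S ps"
    then obtain v vs where c: "walk \<Phi> S v ps vs" "vs \<noteq> []" "last vs = v" "distinct vs"
        "distinct (map fst ps)"
      by (auto simp: is_circle_def)
    \<comment> \<open>A circle has a first step, and the ends of its edge are vertices of the graph;
      this puts \<open>v\<close> into a component.\<close>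
    then obtain p ps' w vs' where "ps = p # ps'" "vs = w # vs'"
      by (cases vs; cases ps) auto
    then have v: "v \<in> verts \<Phi>"
      using c(1) step_from_verts(1)[OF assms, of p v w] by simp
    have "walk \<Phi> (edges_at \<Phi> S (conn \<Phi> S `` {v})) v ps vs"
      using walk_edges_at[OF c(1) assms component_of in_component_of] v by blast
    then show "walk_gain \<Phi> ps = 0"
      using balanced_circle[OF bal[OF v]] c by blast
  qed
qed

text \<open>Each vertex that is not the chosen root of its component is charged to the first edge of a
  shortest walk to the root; no edge is charged twice, since the distance strictly decreases along
  it.\<close>

lemma card_verts_le:
  fixes \<Phi> :: "('v, 'e, 'g::ab_group_add) gain_graph"
  assumes "gain_graph \<Phi>" "S \<subseteq> edges \<Phi>"
  shows "card (verts \<Phi>) \<le> card S + card (components \<Phi> S)"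
proof -
  have fin: "finite (verts \<Phi>)" "finite S"
    using assms by (auto simp: gain_graph_def intro: finite_subset)
  define r where "r W = (SOME v. v \<in> W)" for W :: "'v set"
  define R where "R = r ` components \<Phi> S"
  define root where "root v = r (conn \<Phi> S `` {v})" for v
  define d where "d v = (LEAST k. \<exists>ps. length ps = k \<and> reach \<Phi> S v ps (root v))" for v
  have root: "(v, root v) \<in> conn \<Phi> S" if "v \<in> verts \<Phi>" for v
    using someI[of "\<lambda>w. w \<in> conn \<Phi> S `` {v}", OF in_component_of[OF that]]
    by (simp add: root_def r_def)
  have "\<exists>e\<in>S. \<exists>w. (inc \<Phi> e = Ends v w \<or> inc \<Phi> e = Ends w v) \<and> d w < d v"
    if v: "v \<in> verts \<Phi> - R" for v
  proof -
    have "\<exists>k ps. length ps = k \<and> reach \<Phi> S v ps (root v)"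
      using root v by (auto simp: conn_iff)
    then have "\<exists>ps. length ps = d v \<and> reach \<Phi> S v ps (root v)"
      unfolding d_def by (rule LeastI_ex)
    then obtain ps where ps: "length ps = d v" "reach \<Phi> S v ps (root v)"
      by blast
    have "root v \<in> R"
      unfolding root_def R_def using component_of[of v \<Phi> S] v by blast
    then have "ps \<noteq> []"
      using ps v by auto
    then obtain p ps' where p: "ps = p # ps'"
      by (cases ps) auto
    then obtain w where w: "fst p \<in> S" "step_from \<Phi> v p w" "reach \<Phi> S w ps' (root v)"
      using ps(2) by (auto simp: reach_Cons)
    \<comment> \<open>Adjacent vertices share a root, so \<open>d v\<close> and \<open>d w\<close>
      measure distances to the same target.\<close>
    have "root w = root v"
      using equiv_class_eq[OF equiv_conn step_from_verts(3)[OF assms w(1,2)]]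
      by (simp add: root_def)
    then have "d w \<le> length ps'"
      unfolding d_def using w(3) by (intro Least_le) auto
    then show ?thesis
      using w(1) step_from_ends[OF w(2)] ps(1) p by (intro bexI[of _ "fst p"] exI[of _ w]) auto
  qed
  then obtain f where f: "\<forall>v\<in>verts \<Phi> - R. f v \<in> S \<and>
      (\<exists>w. (inc \<Phi> (f v) = Ends v w \<or> inc \<Phi> (f v) = Ends w v) \<and> d w < d v)"
    by metis
  have "inj_on f (verts \<Phi> - R)"
  proof (rule inj_onI)
    fix v v' assume "v \<in> verts \<Phi> - R" "v' \<in> verts \<Phi> - R" and eq: "f v = f v'"
    then obtain w w' where "inc \<Phi> (f v) = Ends v w \<or> inc \<Phi> (f v) = Ends w v" "d w < d v"
        "inc \<Phi> (f v') = Ends v' w' \<or> inc \<Phi> (f v') = Ends w' v'" "d w' < d v'"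
      using f by meson
    then show "v = v'"
      unfolding eq by (metis incidence.inject(1) less_asym)
  qed
  then have "card (verts \<Phi> - R) \<le> card S"
    using f fin by (intro card_inj_on_le[of f]) auto
  moreover have "card R \<le> card (components \<Phi> S)"
    unfolding R_def by (rule card_image_le[OF finite_components[OF fin(1)]])
  moreover have "card (verts \<Phi>) - card R \<le> card (verts \<Phi> - R)"
    by (rule diff_card_le_card_Diff) (simp add: R_def finite_components[OF fin(1)])
  ultimately show ?thesis
    by linarith
qed

section \<open>Path gains and the behaviour of \<eta> along a component\<close>

lemma path_gain_add:
  assumes "balanced \<Phi> S" "(v, w) \<in> conn \<Phi> S" "(w, x) \<in> conn \<Phi> S"
  shows "path_gain \<Phi> S v x = path_gain \<Phi> S v w + path_gain \<Phi> S w x"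
proof -
  obtain ps qs where "reach \<Phi> S v ps w" "reach \<Phi> S w qs x"
    using assms(2,3) by (auto simp: conn_iff)
  moreover from this have "reach \<Phi> S v (ps @ qs) x"
    by (auto simp: reach_append)
  ultimately show ?thesis
    using path_gain_eq[OF assms(1)] by (metis walk_gain_simps(3))
qed

text \<open>Changing the base point from \<open>v\<close> to \<open>w\<close> translates all path
  gains by the same vector, and translation commutes with the componentwise maximum. Thus
  \<open>- \<eta> \<Phi> S\<close> is itself a potential for the gains on \<open>S\<close>.\<close>

lemma \<eta>_shift:
  assumes "finite (verts \<Phi>)" "balanced \<Phi> S" "(v, w) \<in> conn \<Phi> S"
  shows "\<eta> \<Phi> S v = path_gain \<Phi> S v w + \<eta> \<Phi> S w"
proof -
  let ?W = "conn \<Phi> S `` {w}"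
  have W: "conn \<Phi> S `` {v} = ?W"
    by (rule equiv_class_eq[OF equiv_conn assms(3)])
  have "?W \<subseteq> verts \<Phi>" "w \<in> ?W"
    using assms(3) in_component_of[of w \<Phi> S] by (auto simp: conn_def)
  then have fin: "finite ?W" "?W \<noteq> {}"
    using assms(1) finite_subset by auto
  have "\<eta> \<Phi> S v $ k = path_gain \<Phi> S v w $ k + \<eta> \<Phi> S w $ k" for k
  proof -
    have "(\<lambda>x. path_gain \<Phi> S v x $ k) ` ?W =
        (\<lambda>x. path_gain \<Phi> S w x $ k + path_gain \<Phi> S v w $ k) ` ?W"
      using path_gain_add[OF assms(2,3)] by (intro image_cong) auto
    then show ?thesis
      by (simp add: \<eta>_def W Max_add_commute[OF fin])
  qed
  then show ?thesis
    by (simp add: vec_eq_iff)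
qed

section \<open>Colorings that violate a prescribed edge set\<close>

text \<open>A half edge imposes no condition on a coloring, while a loose edge behaves as a loop of
  gain \<open>0\<close>, whose equation always holds.\<close>

definition violated :: "('v, 'e, 'g::ab_group_add) gain_graph \<Rightarrow> ('v \<Rightarrow> 'g) \<Rightarrow> 'e set" where
  "violated \<Phi> x = {e \<in> edges \<Phi>. case inc \<Phi> e of
     Ends i j \<Rightarrow> x j = x i + gain \<Phi> e | Half i \<Rightarrow> False | Loose \<Rightarrow> True}"

lemma proper_iff_violated: "proper \<Phi> x \<longleftrightarrow> violated \<Phi> x = {}"
  by (auto simp: proper_def violated_def split: incidence.splits)

text \<open>The equations of the violated edges telescope along a walk.\<close>

lemma reach_violated:
  assumes "S \<subseteq> violated \<Phi> x" "reach \<Phi> S v ps w"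
  shows "x w = x v + walk_gain \<Phi> ps"
  using assms(2)
proof (induction ps arbitrary: v)
  case (Cons p ps)
  then obtain y where y: "fst p \<in> S" "step_from \<Phi> v p y" "reach \<Phi> S y ps w"
    by (auto simp: reach_Cons)
  have "fst p \<in> violated \<Phi> x"
    using y(1) assms(1) by auto
  then have "x y = x v + step_gain \<Phi> p"
    using y(2) by (cases p) (auto simp: violated_def split: if_splits)
  then show ?case
    using Cons.IH[OF y(3)] by (simp add: add.assoc)
qed simp

text \<open>Around a circle the color returns to its initial value, so the gain is \<open>0\<close>;
  half edges are never violated.\<close>

lemma violated_imp_balanced:
  assumes "S \<subseteq> violated \<Phi> x"
  shows "balanced \<Phi> S"
  unfolding balanced_def
proof (intro conjI ballI allI impI notI)
  fix e v assume "e \<in> S" "inc \<Phi> e = Half v"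
  then show False
    using assms by (auto simp: violated_def)
next
  fix ps assume "is_circle \<Phi> S ps"
  then obtain v vs where "walk \<Phi> S v ps vs" "vs \<noteq> []" "last vs = v"
    unfolding is_circle_def by blast
  then have "reach \<Phi> S v ps v"
    by (auto simp: reach_def)
  then show "walk_gain \<Phi> ps = 0"
    using reach_violated[OF assms] by fastforce
qed

lemma in_contract_iff: "y \<in> contract \<Phi> S h W \<longleftrightarrow> (\<forall>v\<in>W. y - \<eta> \<Phi> S v \<in> h v)"
  by (force simp: contract_def image_iff)

text \<open>Such colorings correspond to a free choice of one point of
  \<open>contract \<Phi> S h W\<close> for each component \<open>W\<close>. The weights are
  arbitrary here; the lemma is later applied to lists already cut off at \<open>m\<close>.\<close>

lemma card_violating:
  assumes "gain_graph \<Phi>" "S \<subseteq> edges \<Phi>" "balanced \<Phi> S"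
  shows "card {x \<in> verts \<Phi> \<rightarrow>\<^sub>E UNIV. (\<forall>i\<in>verts \<Phi>. x i \<in> h i) \<and> S \<subseteq> violated \<Phi> x} =
    (\<Prod>W\<in>components \<Phi> S. card (contract \<Phi> S h W))"
proof -
  let ?V = "verts \<Phi>" and ?C = "components \<Phi> S"
  let ?X = "{x \<in> ?V \<rightarrow>\<^sub>E UNIV. (\<forall>i\<in>?V. x i \<in> h i) \<and> S \<subseteq> violated \<Phi> x}"
  let ?Y = "\<Pi>\<^sub>E W\<in>?C. contract \<Phi> S h W"
  \<comment> \<open>\<open>?f\<close> reads the constant value of
    \<open>x v + \<eta> \<Phi> S v\<close> at a chosen vertex of each component, and
    \<open>?g\<close> recovers the coloring by subtracting \<eta>.\<close>
  let ?f = "\<lambda>x. \<lambda>W\<in>?C. x (SOME v. v \<in> W) + \<eta> \<Phi> S (SOME v. v \<in> W)"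
  let ?g = "\<lambda>y. \<lambda>v\<in>?V. y (conn \<Phi> S `` {v}) - \<eta> \<Phi> S v"
  have fin: "finite ?V"
    using assms(1) by (simp add: gain_graph_def)
  have some: "(SOME v. v \<in> W) \<in> W" if "W \<in> ?C" for W
    using component_nonempty[OF that] by (simp add: some_in_eq)
  have const: "x v + \<eta> \<Phi> S v = x w + \<eta> \<Phi> S w"
    if x: "x \<in> ?X" and W: "W \<in> ?C" "v \<in> W" "w \<in> W" for x W v w
  proof -
    have vw: "(v, w) \<in> conn \<Phi> S"
      using component_of_eq[OF W(1,2)] W(3) by blast
    then obtain ps where ps: "reach \<Phi> S v ps w"
      by (auto simp: conn_iff)
    then have "x w = x v + path_gain \<Phi> S v w"
      using reach_violated[OF _ ps, of x] x path_gain_eq[OF assms(3) ps] by simp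
    then show ?thesis
      using \<eta>_shift[OF fin assms(3) vw] by (simp add: algebra_simps)
  qed
  have "bij_betw ?f ?X ?Y"
  proof (rule bij_betw_byWitness[where f' = ?g])
    show "\<forall>x\<in>?X. ?g (?f x) = x"
    proof
      fix x assume x: "x \<in> ?X"
      show "?g (?f x) = x"
      proof
        fix v
        show "?g (?f x) v = x v"
        proof (cases "v \<in> ?V")
          case True
          let ?W = "conn \<Phi> S `` {v}"
          have W: "?W \<in> ?C" "v \<in> ?W"
            using component_of in_component_of True by auto
          have "x (SOME v. v \<in> ?W) + \<eta> \<Phi> S (SOME v. v \<in> ?W) = x v + \<eta> \<Phi> S v"
            using const[OF x W(1) some[OF W(1)] W(2)] .
          then show ?thesis
            using True W(1) by simp
        next
          case False
          then show ?thesis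
            using x by (auto simp: PiE_def extensional_def)
        qed
      qed
    qed
    show "\<forall>y\<in>?Y. ?f (?g y) = y"
    proof
      fix y assume y: "y \<in> ?Y"
      show "?f (?g y) = y"
      proof
        fix W
        show "?f (?g y) W = y W"
        proof (cases "W \<in> ?C")
          case True
          have "(SOME v. v \<in> W) \<in> ?V" "conn \<Phi> S `` {SOME v. v \<in> W} = W"
            using some[OF True] component_subset[OF True] component_of_eq[OF True] by auto
          then show ?thesis
            using True by simp
        next
          case False
          then show ?thesis
            using y by (auto simp: PiE_def extensional_def)
        qed
      qed
    qed
    show "?f ` ?X \<subseteq> ?Y"
    proof safe
      fix x W assume x: "x \<in> ?V \<rightarrow>\<^sub>E UNIV" "\<forall>i\<in>?V. x i \<in> h i" "S \<subseteq> violated \<Phi> x" and W: "W \<in> ?C"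
      have "?f x W - \<eta> \<Phi> S v \<in> h v" if "v \<in> W" for v
      proof -
        have "?f x W - \<eta> \<Phi> S v = x v"
          using const[OF _ W some[OF W] that, of x] x W by simp
        then show ?thesis
          using x(2) component_subset[OF W] that by auto
      qed
      then show "?f x W \<in> contract \<Phi> S h W"
        by (simp add: in_contract_iff)
    qed auto
    show "?g ` ?Y \<subseteq> ?X"
    proof
      fix x assume "x \<in> ?g ` ?Y"
      then obtain y where y: "y \<in> ?Y" and x: "x = ?g y"
        by blast
      have "x v \<in> h v" if v: "v \<in> ?V" for v
      proof -
        have "y (conn \<Phi> S `` {v}) \<in> contract \<Phi> S h (conn \<Phi> S `` {v})"
          using y component_of[OF v] by auto
        then show ?thesis
          using in_component_of[OF v] v by (auto simp: x in_contract_iff)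
      qed
      moreover have "S \<subseteq> violated \<Phi> x"
      proof
        fix e assume e: "e \<in> S"
        show "e \<in> violated \<Phi> x"
        proof (cases "inc \<Phi> e")
          case (Ends i j)
          then have step: "fst (e, True) \<in> S" "step_from \<Phi> i (e, True) j"
            using e by auto
          note ij = step_from_verts[OF assms(1,2) step]
          \<comment> \<open>The edge itself is a walk from \<open>i\<close> to \<open>j\<close>.
            This also covers a loop, whose path gain comes from the empty path and whose own gain is
            \<open>0\<close> by balance.\<close>
          have "reach \<Phi> S i [(e, True)] j"
            using step by (simp add: reach_Cons)
          then have "path_gain \<Phi> S i j = gain \<Phi> e"
            using path_gain_eq[OF assms(3)] by fastforce
          then have "\<eta> \<Phi> S i = gain \<Phi> e + \<eta> \<Phi> S j"
            using \<eta>_shift[OF fin assms(3) ij(3)] by simp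
          \<comment> \<open>Both ends lie in one component, so the same value of \<open>y\<close>
            enters \<open>x i\<close> and \<open>x j\<close>, and only the difference of the \<eta>
            terms remains.\<close>
          then have "x j = x i + gain \<Phi> e"
            using equiv_class_eq[OF equiv_conn ij(3)] ij(1,2) by (simp add: x)
          then show ?thesis
            using e assms(2) Ends by (auto simp: violated_def)
        next
          case (Half i)
          then show ?thesis
            using assms(3) e by (auto simp: balanced_def)
        next
          case Loose
          then show ?thesis
            using e assms(2) by (auto simp: violated_def)
        qed
      qed
      ultimately show "x \<in> ?X"
        by (simp add: x)
    qed
  qed
  then have "card ?X = card ?Y"
    by (rule bij_betw_same_card)
  also have "\<dots> = (\<Prod>W\<in>?C. card (contract \<Phi> S h W))"
    by (rule card_PiE[OF finite_components[OF fin]])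
  finally show ?thesis .
qed

section \<open>Contracted weights and finiteness of intervals\<close>

text \<open>Principal down-sets intersect in the one below the componentwise minimum of their tops,
  which exists as \<open>W\<close> is finite and nonempty. A down-set determines its top, so the
  \<open>THE\<close> in \<open>contract_top\<close> is well defined.\<close>

lemma contract_atMost:
  assumes "finite W" "W \<noteq> {}"
  shows "contract \<Phi> S (\<lambda>i. {..m i}) W = {..contract_top \<Phi> S (\<lambda>i. {..m i}) W}"
proof -
  define p where "p = (\<chi> k. Min ((\<lambda>v. (m v + \<eta> \<Phi> S v) $ k) ` W))"
  have "y \<le> p \<longleftrightarrow> (\<forall>v\<in>W. y - \<eta> \<Phi> S v \<le> m v)" for y
    using assms by (auto simp: less_eq_vec_def p_def diff_le_eq)
  then have p: "contract \<Phi> S (\<lambda>i. {..m i}) W = {..p}"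
    by (auto simp: in_contract_iff)
  then have "contract_top \<Phi> S (\<lambda>i. {..m i}) W = p"
    unfolding contract_top_def by (intro the_equality) auto
  with p show ?thesis
    by simp
qed

text \<open>One translate with a lower bound already bounds the intersection. This is needed because
  the substitution for \<open>u\<close> is prescribed only on \<open>\<WW>\<^sub>1\<close>.\<close>

lemma contract_in_\<WW>\<^sub>1:
  assumes "v \<in> W" "h v \<in> \<WW>\<^sub>1"
  shows "contract \<Phi> S h W \<in> \<WW>\<^sub>1"
proof -
  from assms(2) obtain a where a: "h v \<subseteq> {a..}"
    by (auto simp: \<WW>\<^sub>1_def)
  have "contract \<Phi> S h W \<subseteq> {a + \<eta> \<Phi> S v..}"
  proof
    fix y assume "y \<in> contract \<Phi> S h W"
    then have "a \<le> y - \<eta> \<Phi> S v"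
      using assms(1) a by (auto simp: in_contract_iff)
    then show "y \<in> {a + \<eta> \<Phi> S v..}"
      by (auto simp: less_eq_vec_def le_diff_eq)
  qed
  then show ?thesis
    by (auto simp: \<WW>\<^sub>1_def)
qed

lemma finite_int_vec_interval: "finite {a..b :: int ^ 'd}"
proof (rule finite_subset)
  show "{a..b} \<subseteq> vec_lambda ` (\<Pi>\<^sub>E k\<in>UNIV. {a $ k..b $ k})"
  proof
    fix x assume "x \<in> {a..b}"
    then have "($) x \<in> (\<Pi>\<^sub>E k\<in>UNIV. {a $ k..b $ k})"
      by (auto simp: less_eq_vec_def)
    then show "x \<in> vec_lambda ` (\<Pi>\<^sub>E k\<in>UNIV. {a $ k..b $ k})"
      by (rule rev_image_eqI) simp
  qed
  show "finite (vec_lambda ` (\<Pi>\<^sub>E k\<in>UNIV. {a $ k..b $ k}))"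
    by (intro finite_imageI finite_PiE) auto
qed

section \<open>Inclusion-exclusion over edge sets\<close>

text \<open>Adjoining a fixed element pairs off the subsets with opposite signs.\<close>

lemma sum_Pow_alternating:
  assumes "finite A"
  shows "(\<Sum>S\<in>Pow A. (- 1) ^ card S) = (if A = {} then 1 else 0 :: int)"
  using assms
proof (induction A rule: finite_induct)
  case (insert a A)
  have "(\<Sum>S\<in>insert a ` Pow A. (- 1) ^ card S) = (\<Sum>S\<in>Pow A. (- 1) ^ card (insert a S) :: int)"
    using insert by (intro sum.reindex_cong[of "insert a"]) (auto simp: inj_on_def)
  also have "\<dots> = (\<Sum>S\<in>Pow A. - ((- 1) ^ card S))"
    using insert by (intro sum.cong) (auto simp: finite_subset card_insert_if)
  finally show ?case
    using insert by (subst Pow_insert, subst sum.union_disjoint) (auto simp: sum_negf)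
qed simp

theorem theorem5p12:
  fixes \<Phi> :: "('v, 'e, int ^ 'd) gain_graph"
    and h :: "'v \<Rightarrow> (int ^ 'd) set"
    and m :: "'v \<Rightarrow> int ^ 'd"
    and u :: "(int ^ 'd) set \<Rightarrow> int ^ 'd \<Rightarrow> int"
  assumes "gain_graph \<Phi>"
    and "\<forall>i\<in>verts \<Phi>. h i \<in> \<WW>\<^sub>1"
    and "\<forall>h'\<in>\<WW>\<^sub>1. \<forall>m'. u h' m' = - int (card (h' \<inter> {..m'}))"
  shows "int (list_chromatic \<Phi> h m) =
    (-1) ^ card (verts \<Phi>) * eval_uvz (total_dichromatic \<Phi> h (\<lambda>i. {..m i})) u (-1) 0"
proof -
  let ?V = "verts \<Phi>" and ?E = "edges \<Phi>" and ?M = "\<lambda>i. {..m i}"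
  define B where "B = {x \<in> ?V \<rightarrow>\<^sub>E UNIV. \<forall>i\<in>?V. x i \<in> h i \<inter> {..m i}}"
  have fin: "finite ?V" "finite ?E"
    using assms(1) by (auto simp: gain_graph_def)
  have "B = (\<Pi>\<^sub>E i\<in>?V. h i \<inter> {..m i})"
    by (auto simp: B_def PiE_def Pi_def)
  \<comment> \<open>The weight supplies a lower bound and \<open>m i\<close> an upper one.\<close>
  moreover have "finite (h i \<inter> {..m i})" if "i \<in> ?V" for i
  proof -
    obtain a where "h i \<subseteq> {a..}"
      using assms(2) \<open>i \<in> ?V\<close> by (auto simp: \<WW>\<^sub>1_def)
    then have "h i \<inter> {..m i} \<subseteq> {a..m i}"
      by auto
    then show ?thesis
      by (rule finite_subset[OF _ finite_int_vec_interval])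
  qed
  ultimately have "finite B"
    using fin by (simp add: finite_PiE)
  have violated_sub: "violated \<Phi> x \<subseteq> ?E" for x
    by (auto simp: violated_def)

  \<comment> \<open>The term of \<open>S\<close> after substituting \<open>v = -1\<close> and
    \<open>z = 0\<close>; the power of \<open>0\<close> is \<open>1\<close> when all components are
    balanced.\<close>
  define summand where "summand S =
    (-1) ^ (card S + card (\<pi>\<^sub>b \<Phi> S) - card ?V) * 0 ^ (card (components \<Phi> S) - card (\<pi>\<^sub>b \<Phi> S)) *
    (\<Prod>W\<in>\<pi>\<^sub>b \<Phi> S. u (contract \<Phi> S h W) (contract_top \<Phi> S ?M W))" for S
  have summand: "(-1) ^ card ?V * summand S =
      (-1) ^ card S * int (card {x \<in> B. S \<subseteq> violated \<Phi> x})" if S: "S \<subseteq> ?E" for S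
  proof (cases "balanced \<Phi> S")
    case True
    let ?C = "components \<Phi> S"
    have C: "\<pi>\<^sub>b \<Phi> S = ?C"
      using True balanced_iff_components[OF assms(1) S] by simp
    \<comment> \<open>The factor \<open>- 1\<close> is kept separate so that the product yields one
      sign for each component.\<close>
    have "u (contract \<Phi> S h W) (contract_top \<Phi> S ?M W) =
        - 1 * int (card (contract \<Phi> S (\<lambda>i. h i \<inter> {..m i}) W))" if W: "W \<in> ?C" for W
    proof -
      obtain v where v: "v \<in> W" "v \<in> ?V"
        using component_nonempty[OF W] component_subset[OF W] by auto
      have "finite W"
        using component_subset[OF W] fin(1) finite_subset by auto
      then have "contract \<Phi> S h W \<inter> {..contract_top \<Phi> S ?M W} =
          contract \<Phi> S h W \<inter> contract \<Phi> S ?M W"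
        using contract_atMost component_nonempty[OF W] by metis
      also have "\<dots> = contract \<Phi> S (\<lambda>i. h i \<inter> {..m i}) W"
        by (auto simp: in_contract_iff)
      finally show ?thesis
        using assms(2,3) v(2) contract_in_\<WW>\<^sub>1[OF v(1), of h \<Phi> S] by simp
    qed
    then have "(\<Prod>W\<in>?C. u (contract \<Phi> S h W) (contract_top \<Phi> S ?M W)) =
        (-1) ^ card ?C * int (\<Prod>W\<in>?C. card (contract \<Phi> S (\<lambda>i. h i \<inter> {..m i}) W))"
      by (simp only: prod.distrib prod_constant of_nat_prod cong: prod.cong)
    also have "(\<Prod>W\<in>?C. card (contract \<Phi> S (\<lambda>i. h i \<inter> {..m i}) W)) =
        card {x \<in> B. S \<subseteq> violated \<Phi> x}"
      using card_violating[OF assms(1) S True, of "\<lambda>i. h i \<inter> {..m i}"]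
      by (simp add: B_def conj_assoc)
    finally have "(-1) ^ card ?V * summand S =
        (-1) ^ (card ?V + (card S + card ?C - card ?V) + card ?C) *
          int (card {x \<in> B. S \<subseteq> violated \<Phi> x})"
      by (simp add: summand_def C power_add)
    \<comment> \<open>By \<open>card_verts_le\<close> the subtraction is not truncated, so the
      vertex count cancels; the leftover exponent \<open>2 * card ?C\<close> is even.\<close>
    also have "card ?V + (card S + card ?C - card ?V) + card ?C = card S + 2 * card ?C"
      using card_verts_le[OF assms(1) S] by simp
    finally show ?thesis
      by (simp add: power_add)
  next
    case False
    \<comment> \<open>For unbalanced \<open>S\<close> both sides vanish: \<open>0\<close> gets a
      positive exponent, and no coloring violates all of \<open>S\<close>.\<close>
    have "\<pi>\<^sub>b \<Phi> S \<subset> components \<Phi> S"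
      using False balanced_iff_components[OF assms(1) S] by (auto simp: \<pi>\<^sub>b_def)
    then have "card (\<pi>\<^sub>b \<Phi> S) < card (components \<Phi> S)"
      using finite_components[OF fin(1)] by (intro psubset_card_mono)
    then have "summand S = 0"
      by (simp add: summand_def)
    moreover have "{x \<in> B. S \<subseteq> violated \<Phi> x} = {}"
      using False violated_imp_balanced by auto
    ultimately show ?thesis
      by (simp only: card.empty)
  qed

  have "int (list_chromatic \<Phi> h m) = int (card {x \<in> B. violated \<Phi> x = {}})"
    unfolding list_chromatic_def B_def proper_iff_violated
    by (rule arg_cong[of _ _ "\<lambda>A. int (card A)"]) auto
  also have "\<dots> = (\<Sum>x\<in>B. if violated \<Phi> x = {} then 1 else 0)"
    using \<open>finite B\<close> by (simp add: sum.If_cases Int_def)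
  also have "\<dots> = (\<Sum>x\<in>B. \<Sum>S\<in>Pow (violated \<Phi> x). (- 1) ^ card S)"
    using sum_Pow_alternating[OF finite_subset[OF violated_sub fin(2)]] by simp
  \<comment> \<open>Padding with zeros makes the range of \<open>S\<close> independent of
    \<open>x\<close>, so that the two sums can be exchanged.\<close>
  also have "\<dots> = (\<Sum>x\<in>B. \<Sum>S\<in>Pow ?E. if S \<subseteq> violated \<Phi> x then (- 1) ^ card S else 0)"
    using fin(2) violated_sub by (intro sum.cong refl sum.mono_neutral_cong_left) auto
  also have "\<dots> = (\<Sum>S\<in>Pow ?E. \<Sum>x\<in>B. if S \<subseteq> violated \<Phi> x then (- 1) ^ card S else 0)"
    by (rule sum.swap)
  also have "\<dots> = (\<Sum>S\<in>Pow ?E. (- 1) ^ card S * int (card {x \<in> B. S \<subseteq> violated \<Phi> x}))"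
    using \<open>finite B\<close> by (intro sum.cong refl) (simp add: sum.If_cases Int_def)
  also have "\<dots> = (\<Sum>S\<in>Pow ?E. (-1) ^ card ?V * summand S)"
    using summand by (intro sum.cong) auto
  also have "\<dots> = (-1) ^ card ?V * (\<Sum>S\<in>Pow ?E. summand S)"
    by (rule sum_distrib_left[symmetric])
  also have "(\<Sum>S\<in>Pow ?E. summand S) = eval_uvz (total_dichromatic \<Phi> h ?M) u (-1) 0"
    by (simp add: eval_uvz_def total_dichromatic_def summand_def eval_mpoly_sum eval_mpoly_mult
        eval_mpoly_power eval_mpoly_prod eval_mpoly_indet)
  finally show ?thesis .
qed

end
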